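(* Let $T$ be an ergodic measure-preserving map on the probability space $(X,\mathcal{A},\mu)$, and $(A_l)_{l\ge 1}$ a sequence in $\mathcal{A}$ such that $0<\mu(A_l)\to 0$ as $l\to\infty$. Let $\theta>0$. Then the normalized hitting times converge to an exponential law with expectation $1/\theta$, $$\mu\big(\mu(A_l)\,\varphi_{A_l}\le t\big)\Longrightarrow 1-e^{-\theta t}\qquad\text{as } l\to\infty,$$ if and only if for every $\delta\in(0,1]$, $$\mu(\varphi_{A_l}=k_l)\sim \theta e^{-\theta\mu(A_l)k_l}\,\mu(A_l)\qquad\text{as } l\to\infty,\ \text{uniformly in } (k_l)\in\mathcal{K}_\delta(A_l).$$ In this case necessarily $\theta\in(0,1]$. In particular, $\mu(\mu(A_l)\varphi_{A_l}\le t)\Longrightarrow 1-e^{-t}$ as $l\to\infty$ holds if and only if, for all $\delta\in(0,1]$, $\mu(\varphi_{A_l}=k_l)\sim e^{-\mu(A_l)k_l}\,\mu(A_l)$ as $l\to\infty$, uniformly in $(k_l)\in\mathcal{K}_\delta(A_l)$.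
   Context: For $A\in\mathcal{A}$ the hitting time function is $\varphi_A(x):=\inf\{n\ge 1: T^n x\in A\}\in\{1,2,\ldots,\infty\}$, $x\in X$; it is finite a.e. if $\mu(A)>0$. For (sub-)probability distribution functions on $[0,\infty)$, $F_l(t)\Rightarrow F(t)$ means $F_l(t)\to F(t)$ at every continuity point $t$ of $F$. For $\delta\in(0,1]$, $$\mathcal{K}_\delta(A_l):=\{(k_l)_{l\ge 1}: k_l\in\mathbb{N},\ \delta\le \mu(A_l)k_l\le\delta^{-1}\text{ for } l\ge 1\}.$$ Uniformity of $a_l\sim b_l$ in $(k_l)\in\mathcal{K}_\delta(A_l)$ means: for every $\varepsilon>0$ there is $l_0$ such that $|a_l/b_l-1|<\varepsilon$ for all $l\ge l_0$ and all $(k_l)\in\mathcal{K}_\delta(A_l)$. *)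

theory Defs
  imports "HOL-Probability.Probability"
begin

locale ergodic_mpt = prob_space M for M :: "'a measure" +
  fixes T :: "'a \<Rightarrow> 'a"
  assumes T_measurable: "T \<in> measurable M M"
    and T_preserves: "\<And>B. B \<in> sets M \<Longrightarrow> emeasure M (T -` B \<inter> space M) = emeasure M B"
    and T_ergodic: "\<And>B. B \<in> sets M \<Longrightarrow> T -` B \<inter> space M = B \<Longrightarrow>
      emeasure M B = 0 \<or> emeasure M B = 1"

text \<open>The infimum is taken in \<^typ>\<open>enat\<close>, so it is infinite if the orbit never hits \<open>B\<close>.\<close>

definition hitting_time :: "('a \<Rightarrow> 'a) \<Rightarrow> 'a set \<Rightarrow> 'a \<Rightarrow> enat" where
  "hitting_time T B x = Inf {enat n | n. n \<ge> 1 \<and> (T ^^ n) x \<in> B}"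

definition normalized_hitting_cdf :: "'a measure \<Rightarrow> ('a \<Rightarrow> 'a) \<Rightarrow> 'a set \<Rightarrow> real \<Rightarrow> real" where
  "normalized_hitting_cdf M T B t =
    measure M {x \<in> space M. ereal (measure M B) * ereal_of_enat (hitting_time T B x) \<le> ereal t}"

text \<open>Sequences are indexed by \<open>l \<ge> 1\<close>; the value at \<open>0\<close> is unconstrained and irrelevant.
  The lower bound \<open>\<delta>\<close> makes \<open>k l\<close> positive whenever \<open>\<delta> > 0\<close>.\<close>

definition comparable_times :: "'a measure \<Rightarrow> (nat \<Rightarrow> 'a set) \<Rightarrow> real \<Rightarrow> (nat \<Rightarrow> nat) set" where
  "comparable_times M A \<delta> =
    {k. \<forall>l\<ge>1. \<delta> \<le> measure M (A l) * real (k l) \<and> measure M (A l) * real (k l) \<le> inverse \<delta>}"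

definition uniform_asymp_equiv ::
  "(nat \<Rightarrow> nat) set \<Rightarrow> ((nat \<Rightarrow> nat) \<Rightarrow> nat \<Rightarrow> real) \<Rightarrow> ((nat \<Rightarrow> nat) \<Rightarrow> nat \<Rightarrow> real) \<Rightarrow> bool" where
  "uniform_asymp_equiv K a b \<longleftrightarrow>
    (\<forall>\<epsilon>>0. \<exists>l0. \<forall>l\<ge>l0. \<forall>k\<in>K. \<bar>a k l / b k l - 1\<bar> < \<epsilon>)"

end

theory Submission
  imports Defs
begin

text \<open>Write \<open>q n\<close> for the probability that \<open>\<phi>\<^sub>A > n\<close>. Invariance of the measure gives
  \<open>\<mu>(\<phi>\<^sub>A = n + 1) = \<mu>(A \<inter> {\<phi>\<^sub>A > n})\<close>, so the point masses decrease in \<open>n\<close> and are at most \<open>\<mu>(A)\<close>: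
  \<open>q\<close> is convex. A monotone density argument then turns convergence of the
  distribution functions, which is automatically locally uniform, into a local limit theorem.
  The converse is a summation in which the contribution of times below \<open>\<delta> / \<mu>(A)\<close> is
  at most \<open>\<delta>\<close>. Likewise \<open>\<mu>(\<mu>(A) \<phi>\<^sub>A \<le> t) \<le> t\<close>, which forces \<open>\<theta> \<le> 1\<close>.\<close>

section \<open>Convex sequences\<close>

text \<open>The \<open>N\<close> decrements following the one at \<open>n\<close> are all at most
  that one. Together with the backward estimate below, this traps a single decrement between two
  difference quotients over windows of length \<open>N\<close>.\<close>

lemma convex_seq_forward_le:
  fixes q :: "nat \<Rightarrow> real"
  assumes "decseq (\<lambda>n. q n - q (Suc n))"
  shows "q (Suc n) - q (Suc n + N) \<le> real N * (q n - q (Suc n))"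
proof (induction N)
  case (Suc N)
  have "q (Suc n + N) - q (Suc (Suc n + N)) \<le> q n - q (Suc n)"
    using decseqD[OF assms, of n "Suc n + N"] by simp
  with Suc show ?case by (simp add: algebra_simps)
qed simp

text \<open>Mirror image: each of the \<open>N\<close> decrements ending with the one at
  \<open>n\<close> is at least that one, and \<open>N \<le> Suc n\<close> keeps the window within
  the natural numbers.\<close>

lemma convex_seq_backward_ge:
  fixes q :: "nat \<Rightarrow> real"
  assumes "decseq (\<lambda>n. q n - q (Suc n))" and "N \<le> Suc n"
  shows "real N * (q n - q (Suc n)) \<le> q (Suc n - N) - q (Suc n)"
  using assms(2)
proof (induction N)
  case (Suc N)
  have "q n - q (Suc n) \<le> q (n - N) - q (Suc (n - N))"
    using decseqD[OF assms(1), of "n - N" n] by simp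
  moreover have "Suc (n - N) = Suc n - N" "Suc n - Suc N = n - N" using Suc.prems by auto
  ultimately show ?case using Suc by (simp add: algebra_simps)
qed simp

lemma exp_neg_diff_le:
  fixes a b :: real
  assumes "0 \<le> a" "a \<le> b"
  shows "exp (- a) - exp (- b) \<le> b - a"
proof -
  have "exp (- a) - exp (- b) = exp (- a) * (1 - exp (- (b - a)))"
    by (simp add: algebra_simps flip: exp_add)
  also have "\<dots> \<le> 1 * (b - a)"
  proof (intro mult_mono)
    show "1 - exp (- (b - a)) \<le> b - a" using exp_ge_add_one_self[of "- (b - a)"] by linarith
  qed (use assms in auto)
  finally show ?thesis by simp
qed

section \<open>Exponential limits of rescaled convex sequences\<close>

text \<open>Polya's argument: monotone functions that converge pointwise to a continuous limit
  converge locally uniformly. Convergence is used at finitely many grid points, and monotonicity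
  controls the values in between.\<close>

lemma uniform_exponential_approximation:
  fixes q :: "nat \<Rightarrow> nat \<Rightarrow> real" and m :: "nat \<Rightarrow> real"
  assumes "\<theta> > 0"
    and m: "\<And>l. l \<ge> 1 \<Longrightarrow> m l > 0"
    and dec: "\<And>l. l \<ge> 1 \<Longrightarrow> decseq (q l)"
    and lim: "\<And>t. t \<ge> 0 \<Longrightarrow> (\<lambda>l. q l (nat \<lfloor>t / m l\<rfloor>)) \<longlonglongrightarrow> exp (- \<theta> * t)"
    and "\<eta> > 0"
  shows "\<forall>\<^sub>F l in sequentially. \<forall>n. m l * real n \<le> C \<longrightarrow> \<bar>q l n - exp (- \<theta> * m l * real n)\<bar> < \<eta>"
proof -
  \<comment> \<open>With this spacing the exponential varies by at most
    \<open>\<theta> * h = \<eta> / 2\<close> across a grid cell; the other half of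
    \<open>\<eta>\<close> pays for the error at the grid points.\<close>
  define h where "h = \<eta> / (2 * \<theta>)"
  have h: "h > 0" "\<theta> * h = \<eta> / 2" using assms by (auto simp: h_def)
  \<comment> \<open>Large enough that both endpoints of the cell containing any \<open>t\<close> in
    \<open>[0, C]\<close> belong to the grid.\<close>
  define K where "K = Suc (nat \<lfloor>C / h\<rfloor>)"
  have "\<forall>\<^sub>F l in sequentially. \<forall>i\<in>{..K}.
      \<bar>q l (nat \<lfloor>real i * h / m l\<rfloor>) - exp (- \<theta> * (real i * h))\<bar> < \<eta> / 2"
  proof (intro eventually_ball_finite ballI)
    fix i
    have "(\<lambda>l. q l (nat \<lfloor>real i * h / m l\<rfloor>)) \<longlonglongrightarrow> exp (- \<theta> * (real i * h))"
      using h by (intro lim) auto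
    from tendstoD[OF this, of "\<eta> / 2"] \<open>\<eta> > 0\<close>
    show "\<forall>\<^sub>F l in sequentially.
      \<bar>q l (nat \<lfloor>real i * h / m l\<rfloor>) - exp (- \<theta> * (real i * h))\<bar> < \<eta> / 2"
      by (simp add: dist_real_def)
  qed simp
  then show ?thesis
    using eventually_ge_at_top[of 1]
  proof eventually_elim
    case (elim l)
    note ml = m[OF elim(2)]
    show ?case
    proof (intro allI impI)
      fix n assume n: "m l * real n \<le> C"
      define t where "t = m l * real n"
      have t: "0 \<le> t" "t \<le> C" "real n = t / m l" using n ml by (auto simp: t_def)
      define i where "i = nat \<lfloor>t / h\<rfloor>"
      have i_real: "real i = of_int \<lfloor>t / h\<rfloor>" using t h by (simp add: i_def)
      have i: "real i * h \<le> t" "t < real (Suc i) * h"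
        using h floor_divide_lower[of h t] floor_divide_upper[of h t]
        by (auto simp: i_real algebra_simps)
      have "\<lfloor>t / h\<rfloor> \<le> \<lfloor>C / h\<rfloor>" using t h by (intro floor_mono divide_right_mono) auto
      then have iK: "i \<in> {..K}" "Suc i \<in> {..K}" by (auto simp: i_def K_def)
      have n_lower: "nat \<lfloor>real i * h / m l\<rfloor> \<le> n"
      proof -
        have "real i * h / m l \<le> real n" using i ml t by (simp add: divide_right_mono)
        then show ?thesis by (metis floor_mono floor_of_nat nat_int nat_mono)
      qed
      have n_upper: "n \<le> nat \<lfloor>real (Suc i) * h / m l\<rfloor>"
      proof -
        have "real n \<le> real (Suc i) * h / m l"
          using i ml t by (simp add: divide_right_mono del: of_nat_Suc)
        then show ?thesis by (metis floor_mono floor_of_nat nat_int nat_mono)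
      qed
      have q: "q l n \<le> q l (nat \<lfloor>real i * h / m l\<rfloor>)" "q l (nat \<lfloor>real (Suc i) * h / m l\<rfloor>) \<le> q l n"
        using decseqD[OF dec[OF elim(2)]] n_lower n_upper by auto
      have "exp (- (\<theta> * (real i * h))) - exp (- (\<theta> * t)) \<le> \<theta> * t - \<theta> * (real i * h)"
        using i h \<open>\<theta> > 0\<close> by (intro exp_neg_diff_le mult_left_mono mult_nonneg_nonneg) auto
      moreover have "\<theta> * t \<le> \<theta> * (real (Suc i) * h)"
        using i \<open>\<theta> > 0\<close> by (intro mult_left_mono) auto
      moreover have "exp (- (\<theta> * t)) - exp (- (\<theta> * (real (Suc i) * h))) \<le> \<theta> * (real (Suc i) * h) - \<theta> * t"
        using i t \<open>\<theta> > 0\<close> by (intro exp_neg_diff_le mult_left_mono mult_nonneg_nonneg) auto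
      moreover have "\<theta> * (real i * h) \<le> \<theta> * t"
        using i \<open>\<theta> > 0\<close> by (intro mult_left_mono) auto
      moreover have "\<theta> * (real (Suc i) * h) - \<theta> * (real i * h) = \<eta> / 2"
        using h(2) by (simp add: algebra_simps)
      moreover note bspec[OF elim(1) iK(1)] bspec[OF elim(1) iK(2)]
      ultimately have "\<bar>q l n - exp (- (\<theta> * t))\<bar> < \<eta>"
        using q unfolding mult_minus_left by linarith
      then show "\<bar>q l n - exp (- \<theta> * m l * real n)\<bar> < \<eta>" by (simp add: t_def mult.assoc)
    qed
  qed
qed

text \<open>Monotone density argument: \<open>N\<close> times the decrement at \<open>n\<close> lies
  between the losses of \<open>q l\<close> over the \<open>N\<close> steps after and before
  \<open>Suc n\<close>. Over a window of rescaled length about \<open>h\<close>, these losses are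
  known from the exponential approximation, and their ratio to the linear prediction is
  \<open>1 + O(\<theta> * h)\<close>.\<close>

lemma local_limit_from_cdf_limit:
  fixes q :: "nat \<Rightarrow> nat \<Rightarrow> real" and m :: "nat \<Rightarrow> real"
  assumes "\<theta> > 0"
    and m: "\<And>l. l \<ge> 1 \<Longrightarrow> m l > 0" and m0: "m \<longlonglongrightarrow> 0"
    and dec: "\<And>l. l \<ge> 1 \<Longrightarrow> decseq (q l)"
    and conv: "\<And>l. l \<ge> 1 \<Longrightarrow> decseq (\<lambda>n. q l n - q l (Suc n))"
    and lim: "\<And>t. t \<ge> 0 \<Longrightarrow> (\<lambda>l. q l (nat \<lfloor>t / m l\<rfloor>)) \<longlonglongrightarrow> exp (- \<theta> * t)"
    and "\<delta> > 0" "\<epsilon> > 0"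
  shows "\<forall>\<^sub>F l in sequentially. \<forall>n. \<delta> \<le> m l * real (Suc n) \<and> m l * real (Suc n) \<le> inverse \<delta> \<longrightarrow>
    \<bar>(q l n - q l (Suc n)) / (\<theta> * exp (- \<theta> * m l * real (Suc n)) * m l) - 1\<bar> < \<epsilon>"
proof -
  \<comment> \<open>The bound by \<open>\<delta>\<close> leaves room for the backward window, the
    bound by \<open>1 / \<theta>\<close> permits the quadratic estimate of \<open>exp\<close>, and
    the last one keeps the curvature error below \<open>\<epsilon> / 4\<close>.\<close>
  define h where "h = min \<delta> (min (1 / \<theta>) (\<epsilon> / (4 * \<theta>)))"
  have h: "h > 0" "h \<le> \<delta>" "\<theta> * h \<le> 1" "\<theta> * h \<le> \<epsilon> / 4"
  proof -
    show "h > 0" "h \<le> \<delta>" using assms by (auto simp: h_def)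
    have "\<theta> * h \<le> \<theta> * (1 / \<theta>)" "\<theta> * h \<le> \<theta> * (\<epsilon> / (4 * \<theta>))"
      using \<open>\<theta> > 0\<close> by (intro mult_left_mono; simp add: h_def)+
    then show "\<theta> * h \<le> 1" "\<theta> * h \<le> \<epsilon> / 4" using \<open>\<theta> > 0\<close> by auto
  qed
  \<comment> \<open>Chosen so that \<open>2 * \<eta> \<le> y * E * (\<epsilon> / 4)\<close> below,
    given \<open>y \<ge> \<theta> * h / 2\<close> and
    \<open>E \<ge> exp (- \<theta> * inverse \<delta>)\<close>.\<close>
  define \<eta> where "\<eta> = \<epsilon> * (\<theta> * h) * exp (- \<theta> * inverse \<delta>) / 16"
  have "\<eta> > 0" using assms h by (simp add: \<eta>_def)
  \<comment> \<open>The range exceeds \<open>inverse \<delta>\<close> by \<open>h\<close> because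
    the forward window may reach that far.\<close>
  have "\<forall>\<^sub>F l in sequentially. \<forall>n. m l * real n \<le> inverse \<delta> + h \<longrightarrow>
      \<bar>q l n - exp (- \<theta> * m l * real n)\<bar> < \<eta>"
    by (intro uniform_exponential_approximation m dec lim \<open>\<theta> > 0\<close> \<open>\<eta> > 0\<close>)
  moreover have "\<forall>\<^sub>F l in sequentially. m l < h / 2"
    using order_tendstoD(2)[OF m0, of "h / 2"] h by simp
  ultimately show ?thesis
    using eventually_ge_at_top[of 1]
  proof eventually_elim
    case (elim l)
    note ml = m[OF elim(3)]
    \<comment> \<open>The window has \<open>N\<close> steps. Since \<open>m l < h / 2\<close>,
      rounding down costs less than half of \<open>h\<close>, so \<open>y\<close> stays comparable
      to \<open>\<theta> * h\<close>.\<close>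
    define N where "N = nat \<lfloor>h / m l\<rfloor>"
    define y where "y = \<theta> * (m l * real N)"
    have N_real: "real N = of_int \<lfloor>h / m l\<rfloor>" using ml h by (simp add: N_def)
    have N: "m l * real N \<le> h" "h / 2 < m l * real N"
      using ml floor_divide_lower[of "m l" h] floor_divide_upper[of "m l" h] elim(2)
      by (auto simp: N_real algebra_simps)
    have y: "\<theta> * h / 2 \<le> y" "y \<le> \<theta> * h"
      using N \<open>\<theta> > 0\<close> mult_left_mono[of "h/2" "m l * real N" \<theta>] by (auto simp: y_def)
    have y_pos: "0 < y" and y_small: "y \<le> 1" "y \<le> \<epsilon> / 4"
      using y h mult_pos_pos[OF \<open>\<theta> > 0\<close> \<open>h > 0\<close>] by linarith+
    show ?case
    proof (intro allI impI, elim conjE)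
      fix n assume n: "\<delta> \<le> m l * real (Suc n)" "m l * real (Suc n) \<le> inverse \<delta>"
      define p where "p = q l n - q l (Suc n)"
      define E where "E = exp (- \<theta> * m l * real (Suc n))"
      have E: "exp (- \<theta> * inverse \<delta>) \<le> E"
        using n(2) \<open>\<theta> > 0\<close> by (simp add: E_def mult.assoc del: of_nat_Suc)
      have "m l * real N \<le> m l * real (Suc n)" using N n h by linarith
      then have NSuc: "N \<le> Suc n" using ml by (simp del: of_nat_Suc)
      have \<eta>: "2 * \<eta> \<le> y * E * (\<epsilon> / 4)"
      proof -
        have "2 * \<eta> = (\<theta> * h / 2) * exp (- \<theta> * inverse \<delta>) * (\<epsilon> / 4)" by (simp add: \<eta>_def)
        also have "\<dots> \<le> y * E * (\<epsilon> / 4)"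
          using y E y_pos \<open>\<epsilon> > 0\<close> by (intro mult_mono) (auto simp: E_def)
        finally show ?thesis .
      qed
      have approx: "\<bar>q l j - exp (- \<theta> * m l * real j)\<bar> < \<eta>" if "j \<le> Suc n + N" for j
      proof -
        have "m l * real j \<le> m l * real (Suc n + N)" using that ml by (intro mult_left_mono of_nat_mono) simp_all
        also have "\<dots> = m l * real (Suc n) + m l * real N" by (simp add: algebra_simps)
        finally have "m l * real j \<le> inverse \<delta> + h" using n N by linarith
        then show ?thesis using elim(1) by blast
      qed
      have E_back: "exp (- \<theta> * m l * real (Suc n - N)) = E * exp y"
        using NSuc by (simp add: E_def y_def of_nat_diff algebra_simps flip: exp_add)
      have E_forw: "exp (- \<theta> * m l * real (Suc n + N)) = E * exp (- y)"
        by (simp add: E_def y_def algebra_simps flip: exp_add)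
      have E_pos: "E > 0" by (simp add: E_def)
      \<comment> \<open>Upper bound from the backward window, using
        \<open>exp y \<le> 1 + y + y\<^sup>2\<close>; the two approximation errors contribute
        \<open>2 * \<eta>\<close>.\<close>
      have "real N * p \<le> E * exp y - E + 2 * \<eta>"
        using convex_seq_backward_ge[OF conv[OF elim(3)] NSuc] approx[of "Suc n - N", OF le_trans[OF diff_le_self le_add1]] approx[of "Suc n"]
        unfolding E_back p_def E_def[symmetric] by simp
      also have "\<dots> \<le> E * (y + y\<^sup>2) + y * E * (\<epsilon> / 4)"
        using \<eta> mult_left_mono[OF exp_bound[of y], of E] y_pos y_small E_pos
        by (simp add: algebra_simps)
      also have "\<dots> = y * E * (1 + y + \<epsilon> / 4)" by (simp add: algebra_simps power2_eq_square)
      also have "\<dots> \<le> y * E * (1 + \<epsilon> / 2)"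
        using y_pos E_pos y_small by (intro mult_left_mono) auto
      finally have upper: "real N * p \<le> y * E * (1 + \<epsilon> / 2)" .
      \<comment> \<open>Lower bound from the forward window, read from the target upwards and using
        \<open>1 - exp (- y) \<ge> y - y\<^sup>2\<close>.\<close>
      have "y * E * (1 - \<epsilon> / 2) \<le> y * E * (1 - y - \<epsilon> / 4)"
        using y_pos E_pos y_small by (intro mult_left_mono) auto
      also have "\<dots> = E * (y - y\<^sup>2) - y * E * (\<epsilon> / 4)" by (simp add: algebra_simps power2_eq_square)
      also have "\<dots> \<le> E * (1 - exp (- y)) - 2 * \<eta>"
      proof -
        have "exp (- y) \<le> 1 / (1 + y)"
          using exp_ge_add_one_self[of y] y_pos by (simp add: exp_minus field_simps)
        also have "\<dots> \<le> 1 - y + y\<^sup>2"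
          using y_pos by (simp add: field_simps power2_eq_square)
        finally have "E * (y - y\<^sup>2) \<le> E * (1 - exp (- y))" using E_pos by (intro mult_left_mono) auto
        with \<eta> show ?thesis by linarith
      qed
      also have "\<dots> \<le> real N * p"
        using convex_seq_forward_le[OF conv[OF elim(3)], of n N] approx[of "Suc n + N"] approx[of "Suc n"]
        unfolding E_forw p_def E_def[symmetric] right_diff_distrib mult_1_right by linarith
      finally have lower: "y * E * (1 - \<epsilon> / 2) \<le> real N * p" .
      have ratio: "p / (\<theta> * E * m l) = real N * p / (y * E)"
      proof -
        have N0: "real N \<noteq> 0" using y_pos by (cases "N = 0") (simp_all add: y_def)
        have "y * E = real N * (\<theta> * E * m l)" by (simp add: y_def)
        then show ?thesis by (simp only: mult_divide_mult_cancel_left[OF N0])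
      qed
      have yE: "0 < y * E" using y_pos E_pos by simp
      have "1 - \<epsilon> / 2 \<le> p / (\<theta> * E * m l)" "p / (\<theta> * E * m l) \<le> 1 + \<epsilon> / 2"
        unfolding ratio pos_le_divide_eq[OF yE] pos_divide_le_eq[OF yE]
        using upper lower by (simp_all only: mult.commute)
      moreover have "\<bar>\<rho> - 1\<bar> < \<epsilon>" if "1 - \<epsilon> / 2 \<le> \<rho>" "\<rho> \<le> 1 + \<epsilon> / 2" for \<rho>
        using that \<open>\<epsilon> > 0\<close> by linarith
      ultimately have "\<bar>p / (\<theta> * E * m l) - 1\<bar> < \<epsilon>" by blast
      then show "\<bar>(q l n - q l (Suc n)) / (\<theta> * exp (- \<theta> * m l * real (Suc n)) * m l) - 1\<bar> < \<epsilon>"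
        by (simp only: p_def E_def)
    qed
  qed
qed

text \<open>The bound on the decrements with index below \<open>\<delta> / m\<close> cannot exceed \<open>(1 + \<theta>) \<delta>\<close> in total;
  the minimum records this in a form amenable to induction.\<close>

lemma exponential_approximation_from_local_bound:
  fixes q :: "nat \<Rightarrow> real" and m :: real
  assumes "\<theta> > 0" "m > 0" "\<theta> * m \<le> 1" "\<epsilon> > 0" "\<delta> > 0" and q0: "q 0 = 1"
    and bounds: "\<And>n. 0 \<le> q n - q (Suc n)" "\<And>n. q n - q (Suc n) \<le> m"
    and loc: "\<And>n. \<delta> \<le> m * real (Suc n) \<Longrightarrow> m * real (Suc n) \<le> t \<Longrightarrow>
      \<bar>(q n - q (Suc n)) / (\<theta> * exp (- \<theta> * m * real (Suc n)) * m) - 1\<bar> < \<epsilon>"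
    and "m * real n \<le> t"
  shows "\<bar>q n - exp (- \<theta> * m * real n)\<bar> \<le>
    (1 + \<theta>) * min (m * real n) \<delta> + m * real n * (\<epsilon> * \<theta> + \<theta>\<^sup>2 * m)"
  using \<open>m * real n \<le> t\<close>
proof (induction n)
  case (Suc n)
  define e where "e j = exp (- \<theta> * m * real j)" for j
  define p where "p = q n - q (Suc n)"
  define D where "D = p - (e n - e (Suc n))"
  have e: "e n = e (Suc n) * exp (\<theta> * m)"
    by (simp add: e_def algebra_simps flip: exp_add)
  have e_bounds: "0 < e (Suc n)" "e (Suc n) \<le> 1"
    using assms by (auto simp: e_def)
  have pD: "\<bar>q (Suc n) - e (Suc n)\<bar> \<le> \<bar>q n - e n\<bar> + \<bar>D\<bar>"
    by (simp add: D_def p_def)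
  have mn: "m * real n \<le> m * real (Suc n)" using \<open>m > 0\<close> by simp
  have IH: "\<bar>q n - e n\<bar> \<le> (1 + \<theta>) * min (m * real n) \<delta> + m * real n * (\<epsilon> * \<theta> + \<theta>\<^sup>2 * m)"
    using Suc mn unfolding e_def by (intro Suc.IH) linarith
  have c: "0 \<le> m * (\<epsilon> * \<theta> + \<theta>\<^sup>2 * m)" using assms by (intro mult_nonneg_nonneg add_nonneg_nonneg) auto
  have "\<bar>q (Suc n) - e (Suc n)\<bar> \<le>
    (1 + \<theta>) * min (m * real (Suc n)) \<delta> + m * real (Suc n) * (\<epsilon> * \<theta> + \<theta>\<^sup>2 * m)"
  proof (cases "\<delta> \<le> m * real (Suc n)")
    case False
    have e_le: "e n - e (Suc n) \<le> \<theta> * m"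
      using exp_neg_diff_le[of "\<theta> * m * real n" "\<theta> * m * real (Suc n)"] assms
      by (simp add: e_def algebra_simps)
    have "e (Suc n) \<le> e n" unfolding e using e_bounds assms by simp
    then have "\<bar>D\<bar> \<le> (1 + \<theta>) * m"
      using bounds(1)[of n] bounds(2)[of n] e_le \<open>m > 0\<close> mult_pos_pos[OF \<open>\<theta> > 0\<close> \<open>m > 0\<close>]
      unfolding D_def p_def abs_le_iff by (simp add: algebra_simps)
    then show ?thesis using False IH pD mn c by (simp add: min_def algebra_simps)
  next
    case True
    \<comment> \<open>\<open>x\<close> is the predicted decrement. The discrepancy \<open>D\<close>
      splits into the relative error of \<open>p\<close> against \<open>x\<close>, and the
      second-order gap between \<open>x\<close> and the true decrement of the exponential.\<close>
    define x where "x = \<theta> * e (Suc n) * m"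
    have x: "0 < x" using e_bounds assms by (simp add: x_def)
    have "\<bar>p / x - 1\<bar> < \<epsilon>" using loc[OF True Suc.prems] by (simp add: p_def x_def e_def)
    moreover have "p - x = x * (p / x - 1)" using x by (simp add: field_simps)
    ultimately have "\<bar>p - x\<bar> \<le> x * \<epsilon>" using x by (simp add: abs_mult)
    also have "\<dots> \<le> (\<theta> * 1 * m) * \<epsilon>"
      unfolding x_def using e_bounds assms by (intro mult_right_mono mult_left_mono) auto
    finally have 1: "\<bar>p - x\<bar> \<le> m * (\<epsilon> * \<theta>)" by (simp add: mult_ac)
    have "x \<le> e n - e (Suc n)"
      unfolding e x_def using e_bounds mult_left_mono[OF exp_ge_add_one_self[of "\<theta> * m"], of "e (Suc n)"]
      by (simp add: algebra_simps)
    moreover have "e n - e (Suc n) - x \<le> m * (\<theta>\<^sup>2 * m)"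
    proof -
      have "e n - e (Suc n) - x = e (Suc n) * (exp (\<theta> * m) - 1 - \<theta> * m)"
        unfolding e x_def by (simp add: algebra_simps)
      also have "\<dots> \<le> 1 * (\<theta> * m)\<^sup>2"
      proof (intro mult_mono)
        show "exp (\<theta> * m) - 1 - \<theta> * m \<le> (\<theta> * m)\<^sup>2"
          using exp_bound[of "\<theta> * m"] assms by simp
        show "0 \<le> exp (\<theta> * m) - 1 - \<theta> * m"
          using exp_ge_add_one_self[of "\<theta> * m"] by linarith
      qed (use e_bounds in auto)
      finally show ?thesis by (simp add: power2_eq_square mult_ac)
    qed
    ultimately have "\<bar>D\<bar> \<le> m * (\<epsilon> * \<theta>) + m * (\<theta>\<^sup>2 * m)"
      using 1 unfolding D_def abs_le_iff by linarith
    moreover have "(1 + \<theta>) * min (m * real n) \<delta> \<le> (1 + \<theta>) * min (m * real (Suc n)) \<delta>"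
      using \<open>m > 0\<close> \<open>\<theta> > 0\<close> by (intro mult_left_mono min.mono) auto
    ultimately show ?thesis using IH pD by (simp add: algebra_simps)
  qed
  then show ?case by (simp only: e_def)
qed (use assms in auto)

text \<open>Summing the decrements up to time \<open>t\<close> leaves three errors: early times, the
  accumulated relative error, and the discretization of the exponential. Each is made at most
  \<open>r / 4\<close>; rounding \<open>t\<close> to a multiple of \<open>m l\<close> is harmless
  since \<open>m l\<close> tends to \<open>0\<close>.\<close>

lemma cdf_limit_from_local_limit:
  fixes q :: "nat \<Rightarrow> nat \<Rightarrow> real" and m :: "nat \<Rightarrow> real"
  assumes "\<theta> > 0"
    and m: "\<And>l. l \<ge> 1 \<Longrightarrow> m l > 0" and m0: "m \<longlonglongrightarrow> 0"
    and q0: "\<And>l. l \<ge> 1 \<Longrightarrow> q l 0 = 1"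
    and bounds: "\<And>l n. l \<ge> 1 \<Longrightarrow> 0 \<le> q l n - q l (Suc n)"
      "\<And>l n. l \<ge> 1 \<Longrightarrow> q l n - q l (Suc n) \<le> m l"
    and loc: "\<And>\<delta> \<epsilon>. 0 < \<delta> \<Longrightarrow> \<delta> \<le> 1 / 2 \<Longrightarrow> \<epsilon> > 0 \<Longrightarrow> \<forall>\<^sub>F l in sequentially.
      \<forall>n. \<delta> \<le> m l * real (Suc n) \<and> m l * real (Suc n) \<le> inverse \<delta> \<longrightarrow>
      \<bar>(q l n - q l (Suc n)) / (\<theta> * exp (- \<theta> * m l * real (Suc n)) * m l) - 1\<bar> < \<epsilon>"
    and "t \<ge> 0"
  shows "(\<lambda>l. q l (nat \<lfloor>t / m l\<rfloor>)) \<longlonglongrightarrow> exp (- \<theta> * t)"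
proof -
  define n where "n l = nat \<lfloor>t / m l\<rfloor>" for l
  have n_real: "t - m l \<le> m l * real (n l)" "m l * real (n l) \<le> t" if "l \<ge> 1" for l
  proof -
    have "real (n l) = of_int \<lfloor>t / m l\<rfloor>" using m[OF that] \<open>t \<ge> 0\<close> by (simp add: n_def)
    then show "t - m l \<le> m l * real (n l)" "m l * real (n l) \<le> t"
      using floor_divide_lower[of "m l" t] floor_divide_upper[of "m l" t] m[OF that]
      by (auto simp: algebra_simps)
  qed
  have "(\<lambda>l. m l * real (n l)) \<longlonglongrightarrow> t"
  proof (rule tendsto_sandwich)
    show "\<forall>\<^sub>F l in sequentially. t - m l \<le> m l * real (n l)"
      "\<forall>\<^sub>F l in sequentially. m l * real (n l) \<le> t"
      using n_real by (auto intro: eventually_sequentiallyI[of 1])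
    show "(\<lambda>l. t - m l) \<longlonglongrightarrow> t" using tendsto_diff[OF tendsto_const m0, of t] by simp
  qed simp
  then have "(\<lambda>l. exp (- \<theta> * (m l * real (n l)))) \<longlonglongrightarrow> exp (- \<theta> * t)"
    by (intro tendsto_intros)
  moreover have "(\<lambda>l. q l (n l) - exp (- \<theta> * (m l * real (n l)))) \<longlonglongrightarrow> 0"
  proof (rule tendstoI)
    fix r :: real assume "r > 0"
    \<comment> \<open>The three bounds serve, in order, to make \<open>loc\<close> applicable, to
      place \<open>t\<close> below \<open>inverse \<delta>\<close>, and to limit the early times to
      \<open>r / 4\<close>.\<close>
    define \<delta> where "\<delta> = min (1 / 2) (min (inverse (t + 1)) (r / (4 * (1 + \<theta>))))"
    have "\<delta> \<le> inverse (t + 1)" by (simp add: \<delta>_def)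
    moreover have \<delta>0: "\<delta> \<le> 1 / 2" unfolding \<delta>_def by (rule min.cobounded1)
    moreover have \<delta>_pos: "0 < \<delta>" using \<open>r > 0\<close> \<open>t \<ge> 0\<close> \<open>\<theta> > 0\<close> by (auto simp: \<delta>_def)
    ultimately have "t + 1 \<le> inverse \<delta>" using \<open>t \<ge> 0\<close> by (simp add: field_simps)
    then have t\<delta>: "t \<le> inverse \<delta>" by simp
    have "\<delta> \<le> r / (4 * (1 + \<theta>))" by (simp add: \<delta>_def)
    then have \<delta>r: "(1 + \<theta>) * \<delta> \<le> r / 4" using \<open>\<theta> > 0\<close> by (simp add: field_simps)
    \<comment> \<open>Makes the accumulated relative error
      \<open>t * (\<epsilon> * \<theta>)\<close> at most \<open>r / 4\<close>; writing
      \<open>t + 1\<close> covers \<open>t = 0\<close>.\<close>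
    define \<epsilon> where "\<epsilon> = r / (4 * \<theta> * (t + 1))"
    have \<epsilon>: "\<epsilon> > 0" "t * (\<epsilon> * \<theta>) \<le> r / 4"
    proof -
      show "\<epsilon> > 0" using \<open>r > 0\<close> \<open>t \<ge> 0\<close> \<open>\<theta> > 0\<close> by (simp add: \<epsilon>_def)
      have "t * (\<epsilon> * \<theta>) = r / 4 * (t / (t + 1))" using \<open>\<theta> > 0\<close> by (simp add: \<epsilon>_def)
      also have "\<dots> \<le> r / 4 * 1"
        using \<open>r > 0\<close> \<open>t \<ge> 0\<close> by (intro mult_left_mono) (auto simp: divide_le_eq)
      finally show "t * (\<epsilon> * \<theta>) \<le> r / 4" by simp
    qed
    have "(\<lambda>l. \<theta> * m l) \<longlonglongrightarrow> \<theta> * 0" "(\<lambda>l. t * (\<theta>\<^sup>2 * m l)) \<longlonglongrightarrow> t * (\<theta>\<^sup>2 * 0)"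
      by (intro tendsto_intros m0)+
    then have "\<forall>\<^sub>F l in sequentially. \<theta> * m l < 1"
      "\<forall>\<^sub>F l in sequentially. t * (\<theta>\<^sup>2 * m l) < r / 4"
      using \<open>r > 0\<close> by (auto dest: order_tendstoD(2)[of _ _ _ 1]
          order_tendstoD(2)[of _ _ _ "r / 4"])
    with loc[OF \<delta>_pos \<delta>0 \<open>\<epsilon> > 0\<close>]
    show "\<forall>\<^sub>F l in sequentially. dist (q l (n l) - exp (- \<theta> * (m l * real (n l)))) 0 < r"
      using eventually_ge_at_top[of 1]
    proof eventually_elim
      case (elim l)
      note l = \<open>1 \<le> l\<close>
      have "\<bar>q l (n l) - exp (- \<theta> * m l * real (n l))\<bar> \<le>
        (1 + \<theta>) * min (m l * real (n l)) \<delta> + m l * real (n l) * (\<epsilon> * \<theta> + \<theta>\<^sup>2 * m l)"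
      proof (rule exponential_approximation_from_local_bound[OF \<open>\<theta> > 0\<close> m[OF l]
            less_imp_le[OF elim(2)] \<open>\<epsilon> > 0\<close> \<delta>_pos q0[OF l] bounds[OF l] _ n_real(2)[OF l]])
        fix j assume j: "\<delta> \<le> m l * real (Suc j)" "m l * real (Suc j) \<le> t"
        show "\<bar>(q l j - q l (Suc j)) / (\<theta> * exp (- \<theta> * m l * real (Suc j)) * m l) - 1\<bar> < \<epsilon>"
          using elim(1) j(1) order.trans[OF j(2) t\<delta>] by blast
      qed
      also have "\<dots> \<le> (1 + \<theta>) * \<delta> + t * (\<epsilon> * \<theta> + \<theta>\<^sup>2 * m l)"
        using \<open>\<theta> > 0\<close> \<open>\<epsilon> > 0\<close> m[OF l] n_real[OF l]
        by (intro add_mono mult_left_mono mult_right_mono add_nonneg_nonneg mult_nonneg_nonneg) auto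
      also have "\<dots> < r" using \<delta>r \<epsilon>(2) elim(3) \<open>r > 0\<close> by (simp add: distrib_left)
      finally show ?case by (simp add: dist_real_def mult.assoc)
    qed
  qed
  ultimately have "(\<lambda>l. (q l (n l) - exp (- \<theta> * (m l * real (n l)))) + exp (- \<theta> * (m l * real (n l))))
      \<longlonglongrightarrow> 0 + exp (- \<theta> * t)"
    by (intro tendsto_add)
  then show ?thesis by (simp add: n_def)
qed

section \<open>Hitting times\<close>

text \<open>Replaces the infimum by finitely many conditions on the orbit, so that infinite hitting
  times require no separate treatment.\<close>

lemma hitting_time_gt_iff:
  "enat n < hitting_time T B x \<longleftrightarrow> (\<forall>j\<in>{1..n}. (T ^^ j) x \<notin> B)"
proof
  assume *: "enat n < hitting_time T B x"
  show "\<forall>j\<in>{1..n}. (T ^^ j) x \<notin> B"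
  proof (intro ballI notI)
    fix j assume j: "j \<in> {1..n}" "(T ^^ j) x \<in> B"
    then have "hitting_time T B x \<le> enat j"
      unfolding hitting_time_def by (intro Inf_lower) auto
    also have "enat j \<le> enat n" using j by simp
    finally show False using * by simp
  qed
next
  assume *: "\<forall>j\<in>{1..n}. (T ^^ j) x \<notin> B"
  have "enat (Suc n) \<le> hitting_time T B x"
    unfolding hitting_time_def
  proof (rule Inf_greatest)
    fix y assume "y \<in> {enat k | k. k \<ge> 1 \<and> (T ^^ k) x \<in> B}"
    then obtain k where "y = enat k" "k \<ge> 1" "(T ^^ k) x \<in> B" by blast
    then show "enat (Suc n) \<le> y" using * by (cases "k \<le> n") auto
  qed
  then show "enat n < hitting_time T B x" by (simp add: Suc_ile_eq)
qed

lemma hitting_time_eq_Suc_iff: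
  "hitting_time T B x = enat (Suc n) \<longleftrightarrow>
    enat n < hitting_time T B x \<and> \<not> enat (Suc n) < hitting_time T B x"
  by (cases "hitting_time T B x") auto

section \<open>Survival sets and invariance of the measure\<close>

definition survival_set :: "'a measure \<Rightarrow> ('a \<Rightarrow> 'a) \<Rightarrow> 'a set \<Rightarrow> nat \<Rightarrow> 'a set" where
  "survival_set M T B n = {x \<in> space M. enat n < hitting_time T B x}"

lemma survival_set_0 [simp]: "survival_set M T B 0 = space M"
  by (auto simp: survival_set_def hitting_time_gt_iff)

lemma decseq_survival_set: "decseq (survival_set M T B)"
  by (rule decseq_SucI) (auto simp: survival_set_def hitting_time_gt_iff)

context ergodic_mpt
begin

text \<open>The orbit of \<open>x\<close> at times \<open>1\<close> to \<open>Suc n\<close> is the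
  orbit of \<open>T x\<close> at times \<open>0\<close> to \<open>n\<close>. Having a preimage under
  \<open>T\<close> gives measurability by induction and makes invariance applicable.\<close>

lemma survival_set_Suc:
  "survival_set M T B (Suc n) = T -` (survival_set M T B n - B) \<inter> space M"
proof -
  have "(\<forall>j\<in>{1..Suc n}. (T ^^ j) x \<notin> B) \<longleftrightarrow> (\<forall>j\<in>{1..n}. (T ^^ j) (T x) \<notin> B) \<and> T x \<notin> B" for x
  proof -
    have "(\<forall>j\<in>{1..Suc n}. (T ^^ j) x \<notin> B) \<longleftrightarrow> (\<forall>j\<in>{0..n}. (T ^^ Suc j) x \<notin> B)"
      unfolding One_nat_def image_Suc_atLeastAtMost[symmetric] by blast
    also have "{0..n} = insert 0 {1..n}" by auto
    also have "(\<forall>j\<in>insert 0 {1..n}. (T ^^ Suc j) x \<notin> B) \<longleftrightarrow>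
        (\<forall>j\<in>insert 0 {1..n}. (T ^^ j) (T x) \<notin> B)"
      by (simp only: funpow_Suc_right o_apply)
    finally show ?thesis by auto
  qed
  then show ?thesis
    using measurable_space[OF T_measurable] by (auto simp: survival_set_def hitting_time_gt_iff)
qed

lemma survival_set_measurable:
  assumes "B \<in> sets M"
  shows "survival_set M T B n \<in> sets M"
proof (induction n)
  case (Suc n)
  then show ?case
    unfolding survival_set_Suc using assms by (intro measurable_sets[OF T_measurable]) auto
qed simp

text \<open>By invariance, one further step loses exactly the mass of the points of \<open>B\<close>
  that survive \<open>n\<close> steps. These sets shrink with \<open>n\<close> and lie in
  \<open>B\<close>, which is the source of both convexity and the bound by
  \<open>prob B\<close>.\<close>

lemma prob_survival_set_Suc:
  assumes "B \<in> sets M"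
  shows "prob (survival_set M T B n) - prob (survival_set M T B (Suc n)) = prob (survival_set M T B n \<inter> B)"
proof -
  note S = survival_set_measurable[OF assms]
  have "prob (survival_set M T B (Suc n)) = prob (survival_set M T B n - B)"
    unfolding survival_set_Suc measure_def using assms S by (subst T_preserves) auto
  also have "\<dots> = prob (survival_set M T B n) - prob (survival_set M T B n \<inter> B)"
    using S assms by (rule finite_measure_Diff')
  finally show ?thesis by simp
qed

lemma prob_hitting_time_eq_Suc:
  assumes "B \<in> sets M"
  shows "prob {x \<in> space M. hitting_time T B x = enat (Suc n)} =
    prob (survival_set M T B n) - prob (survival_set M T B (Suc n))"
proof -
  have "{x \<in> space M. hitting_time T B x = enat (Suc n)} =
      survival_set M T B n - survival_set M T B (Suc n)"
    by (auto simp: survival_set_def hitting_time_eq_Suc_iff)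
  then show ?thesis
    using survival_set_measurable[OF assms] decseqD[OF decseq_survival_set[of M T B], of n "Suc n"]
    by (simp add: finite_measure_Diff)
qed

lemma decseq_prob_survival_set:
  assumes "B \<in> sets M"
  shows "decseq (\<lambda>n. prob (survival_set M T B n))"
  unfolding decseq_def
proof (intro allI impI)
  fix i j :: nat assume "i \<le> j"
  then show "prob (survival_set M T B j) \<le> prob (survival_set M T B i)"
    by (rule finite_measure_mono[OF decseqD[OF decseq_survival_set] survival_set_measurable[OF assms]])
qed

lemma convex_prob_survival_set:
  assumes "B \<in> sets M"
  shows "decseq (\<lambda>n. prob (survival_set M T B n) - prob (survival_set M T B (Suc n)))"
  unfolding prob_survival_set_Suc[OF assms] decseq_def
proof (intro allI impI finite_measure_mono)
  fix i j :: nat assume "i \<le> j"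
  then show "survival_set M T B j \<inter> B \<subseteq> survival_set M T B i \<inter> B"
    using decseqD[OF decseq_survival_set[of M T B]] by blast
qed (use survival_set_measurable[OF assms] assms in auto)

lemma prob_survival_set_diff_le:
  assumes "B \<in> sets M"
  shows "prob (survival_set M T B n) - prob (survival_set M T B (Suc n)) \<le> prob B"
  unfolding prob_survival_set_Suc[OF assms] using assms by (intro finite_measure_mono) auto

text \<open>Each step loses at most \<open>prob B\<close>. In the limit this linear bound forces
  \<open>\<theta> \<le> 1\<close>.\<close>

lemma prob_survival_set_ge:
  assumes "B \<in> sets M"
  shows "1 - prob B * real n \<le> prob (survival_set M T B n)"
proof (induction n)
  case 0
  then show ?case by (simp add: prob_space)
next
  case (Suc n)
  then show ?case using prob_survival_set_diff_le[OF assms, of n] by (simp add: algebra_simps)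
qed

section \<open>Distribution function of the normalized hitting time\<close>

lemma normalized_hitting_cdf_nonneg:
  assumes "B \<in> sets M" "prob B > 0" "t \<ge> 0"
  shows "normalized_hitting_cdf M T B t = 1 - prob (survival_set M T B (nat \<lfloor>t / prob B\<rfloor>))"
proof -
  have "ereal (prob B) * ereal_of_enat (hitting_time T B x) \<le> ereal t \<longleftrightarrow>
      \<not> enat (nat \<lfloor>t / prob B\<rfloor>) < hitting_time T B x" for x
  proof (cases "hitting_time T B x")
    case (enat k)
    have "prob B * real k \<le> t \<longleftrightarrow> real k \<le> t / prob B"
      using assms by (simp add: le_divide_eq mult.commute)
    also have "\<dots> \<longleftrightarrow> k \<le> nat \<lfloor>t / prob B\<rfloor>"
      using assms by (simp add: le_nat_iff le_floor_iff)
    finally show ?thesis using enat by (simp add: not_less)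
  \<comment> \<open>For an infinite hitting time, \<open>prob B > 0\<close> makes the product
    infinite, so both sides are false.\<close>
  qed (use assms in auto)
  then have "{x \<in> space M. ereal (prob B) * ereal_of_enat (hitting_time T B x) \<le> ereal t} =
      space M - survival_set M T B (nat \<lfloor>t / prob B\<rfloor>)"
    by (auto simp: survival_set_def)
  then show ?thesis
    using survival_set_measurable[OF assms(1)] by (simp add: normalized_hitting_cdf_def prob_compl)
qed

lemma normalized_hitting_cdf_neg:
  assumes "t < 0"
  shows "normalized_hitting_cdf M T B t = 0"
proof -
  have "\<not> ereal (prob B) * ereal_of_enat (hitting_time T B x) \<le> ereal t" for x
  proof -
    have "0 \<le> ereal (prob B) * ereal_of_enat (hitting_time T B x)"
      by (intro ereal_0_le_mult) auto
    with assms show ?thesis by (metis ereal_less(1) leD order.strict_trans1 zero_ereal_def less_ereal.simps(1))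
  qed
  then show ?thesis by (simp add: normalized_hitting_cdf_def)
qed

section \<open>Distributional and local limits\<close>

text \<open>The limit is continuous everywhere, so weak convergence is pointwise convergence at
  every \<open>t\<close>, and at negative \<open>t\<close> all functions vanish.\<close>

lemma weak_conv_exponential_iff:
  assumes A: "\<And>l. l \<ge> 1 \<Longrightarrow> A l \<in> sets M" and pos: "\<And>l. l \<ge> 1 \<Longrightarrow> prob (A l) > 0"
  shows "weak_conv (\<lambda>l. normalized_hitting_cdf M T (A l)) (\<lambda>t. if t < 0 then 0 else 1 - exp (- \<theta> * t))
    \<longleftrightarrow> (\<forall>t\<ge>0. (\<lambda>l. prob (survival_set M T (A l) (nat \<lfloor>t / prob (A l)\<rfloor>))) \<longlonglongrightarrow> exp (- \<theta> * t))"
    (is "weak_conv ?F ?G \<longleftrightarrow> (\<forall>t\<ge>0. ?S t)")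
proof -
  \<comment> \<open>Both branches give \<open>0\<close> at \<open>t = 0\<close>, so the case split
    may be moved to \<open>t \<le> 0\<close> and the two pieces glued along closed
    half-lines.\<close>
  have "continuous_on ({..0} \<union> {0..}) ?G"
  proof (rule continuous_on_cong[THEN iffD1, rotated 2])
    show "continuous_on ({..0} \<union> {0..}) (\<lambda>t. if t \<le> 0 then 0 else 1 - exp (- \<theta> * t))"
      by (rule continuous_on_If) (auto intro!: continuous_intros)
  qed auto
  moreover have "{..0} \<union> {0..} = (UNIV :: real set)" by auto
  ultimately have cont: "isCont ?G t" for t by (simp add: continuous_on_eq_continuous_at)
  have neg: "(\<lambda>l. ?F l t) \<longlonglongrightarrow> ?G t" if "t < 0" for t
    using that by (simp add: normalized_hitting_cdf_neg)
  have nonneg: "(\<lambda>l. ?F l t) \<longlonglongrightarrow> ?G t \<longleftrightarrow> ?S t" if "t \<ge> 0" for t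
  proof -
    have "\<forall>\<^sub>F l in sequentially. ?F l t = 1 - prob (survival_set M T (A l) (nat \<lfloor>t / prob (A l)\<rfloor>))"
      using A pos that by (intro eventually_sequentiallyI[of 1] normalized_hitting_cdf_nonneg)
    then have "(\<lambda>l. ?F l t) \<longlonglongrightarrow> ?G t \<longleftrightarrow>
        (\<lambda>l. 1 - prob (survival_set M T (A l) (nat \<lfloor>t / prob (A l)\<rfloor>))) \<longlonglongrightarrow> 1 - exp (- \<theta> * t)"
      using that by (subst tendsto_cong) auto
    also have "\<dots> \<longleftrightarrow> ?S t"
      using tendsto_diff[OF tendsto_const[of "1::real"]] by fastforce
    finally show ?thesis .
  qed
  show ?thesis
    unfolding weak_conv_def
  proof (intro iffI allI impI)
    fix t :: real assume "\<forall>t. isCont ?G t \<longrightarrow> (\<lambda>l. ?F l t) \<longlonglongrightarrow> ?G t" "t \<ge> 0"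
    then show "?S t" using cont nonneg by blast
  next
    fix t assume S: "\<forall>t\<ge>0. ?S t"
    show "(\<lambda>l. ?F l t) \<longlonglongrightarrow> ?G t"
    proof (cases "t < 0")
      case True
      then show ?thesis by (rule neg)
    next
      case False
      then have "t \<ge> 0" by simp
      with S show ?thesis unfolding nonneg[OF \<open>t \<ge> 0\<close>] by blast
    qed
  qed
qed

text \<open>For \<open>\<delta> \<le> 1 / 2\<close> every interval \<open>[\<delta> / \<mu>(A\<^sub>l), 1 / (\<delta> \<mu>(A\<^sub>l))]\<close> has length at least \<open>1\<close> and so
  contains an integer. For larger \<open>\<delta>\<close> the set of comparable sequences may be empty.\<close>

lemma comparable_times_extend:
  assumes pos: "\<And>l. l \<ge> 1 \<Longrightarrow> prob (A l) > 0" and "0 < \<delta>" "\<delta> \<le> 1 / 2"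
    and k: "\<delta> \<le> prob (A l) * real k" "prob (A l) * real k \<le> inverse \<delta>"
  shows "\<exists>\<kappa>\<in>comparable_times M A \<delta>. \<kappa> l = k"
proof -
  \<comment> \<open>The least integer time reaching the lower bound. Its rescaled value is at most
    \<open>\<delta> + prob (A j) \<le> 3 / 2\<close>, hence below
    \<open>2 \<le> inverse \<delta>\<close>.\<close>
  define \<kappa> where "\<kappa> = (\<lambda>j. nat \<lceil>\<delta> / prob (A j)\<rceil>)"
  have "\<delta> \<le> prob (A j) * real (\<kappa> j) \<and> prob (A j) * real (\<kappa> j) \<le> inverse \<delta>" if "j \<ge> 1" for j
  proof
    note p = pos[OF that]
    have "real (\<kappa> j) = of_int \<lceil>\<delta> / prob (A j)\<rceil>"
      using p \<open>0 < \<delta>\<close> by (simp add: \<kappa>_def ceiling_le_iff le_of_int_ceiling order.trans[of 0 "\<delta> / prob (A j)"])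
    then have "\<delta> / prob (A j) \<le> real (\<kappa> j)" "real (\<kappa> j) \<le> \<delta> / prob (A j) + 1"
      by linarith+
    then have *: "\<delta> \<le> prob (A j) * real (\<kappa> j)" "prob (A j) * real (\<kappa> j) \<le> \<delta> + prob (A j)"
      using p by (simp_all add: field_simps)
    then show "\<delta> \<le> prob (A j) * real (\<kappa> j)" by simp
    have "2 \<le> inverse \<delta>" using assms(2,3) by (simp add: field_simps)
    then show "prob (A j) * real (\<kappa> j) \<le> inverse \<delta>"
      using * prob_le_1[of "A j"] assms(3) by linarith
  qed
  then have "\<kappa>(l := k) \<in> comparable_times M A \<delta>" using k by (auto simp: comparable_times_def)
  then show ?thesis by (metis fun_upd_same)
qed

text \<open>Links uniformity over sequences \<open>k\<close> with uniformity over single times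
  \<open>Suc n\<close>, which is the form of the analytic lemmas. Positivity of
  \<open>\<delta>\<close> excludes the time \<open>0\<close>.\<close>

lemma hitting_time_local_limit_iff:
  assumes A: "\<And>l. l \<ge> 1 \<Longrightarrow> A l \<in> sets M" and pos: "\<And>l. l \<ge> 1 \<Longrightarrow> prob (A l) > 0"
    and lim0: "(\<lambda>l. prob (A l)) \<longlonglongrightarrow> 0" and "\<theta> > 0"
  shows "weak_conv (\<lambda>l. normalized_hitting_cdf M T (A l)) (\<lambda>t. if t < 0 then 0 else 1 - exp (- \<theta> * t))
    \<longleftrightarrow> (\<forall>\<delta>\<in>{0<..1}. uniform_asymp_equiv (comparable_times M A \<delta>)
        (\<lambda>k l. prob {x \<in> space M. hitting_time T (A l) x = enat (k l)})
        (\<lambda>k l. \<theta> * exp (- \<theta> * prob (A l) * real (k l)) * prob (A l)))"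
    (is "?W \<longleftrightarrow> ?U")
proof -
  define q where "q l n = prob (survival_set M T (A l) n)" for l n
  note dec = decseq_prob_survival_set[OF A, folded q_def]
  note conv = convex_prob_survival_set[OF A, folded q_def]
  note hit = prob_hitting_time_eq_Suc[OF A, folded q_def]
  have W: "?W \<longleftrightarrow> (\<forall>t\<ge>0. (\<lambda>l. q l (nat \<lfloor>t / prob (A l)\<rfloor>)) \<longlonglongrightarrow> exp (- \<theta> * t))"
    unfolding q_def by (rule weak_conv_exponential_iff[OF A pos])
  show ?thesis
  proof
    assume ?W
    show ?U
      unfolding uniform_asymp_equiv_def
    proof (intro ballI allI impI)
      fix \<delta> \<epsilon> :: real assume \<delta>: "\<delta> \<in> {0<..1}" and "\<epsilon> > 0"
      have "\<forall>\<^sub>F l in sequentially.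
          \<forall>n. \<delta> \<le> prob (A l) * real (Suc n) \<and> prob (A l) * real (Suc n) \<le> inverse \<delta> \<longrightarrow>
          \<bar>(q l n - q l (Suc n)) / (\<theta> * exp (- \<theta> * prob (A l) * real (Suc n)) * prob (A l)) - 1\<bar> < \<epsilon>"
        using \<open>?W\<close> \<delta> unfolding W
        by (intro local_limit_from_cdf_limit \<open>\<theta> > 0\<close> \<open>\<epsilon> > 0\<close> pos lim0 dec conv) auto
      then obtain l0 where l0: "\<And>l n. l \<ge> l0 \<Longrightarrow> \<delta> \<le> prob (A l) * real (Suc n) \<Longrightarrow>
          prob (A l) * real (Suc n) \<le> inverse \<delta> \<Longrightarrow>
          \<bar>(q l n - q l (Suc n)) / (\<theta> * exp (- \<theta> * prob (A l) * real (Suc n)) * prob (A l)) - 1\<bar> < \<epsilon>"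
        unfolding eventually_sequentially by blast
      \<comment> \<open>Starting at \<open>max 1 l0\<close> matters because comparable sequences are
        constrained only for \<open>l \<ge> 1\<close>.\<close>
      have "\<bar>prob {x \<in> space M. hitting_time T (A l) x = enat (k l)} /
          (\<theta> * exp (- \<theta> * prob (A l) * real (k l)) * prob (A l)) - 1\<bar> < \<epsilon>"
        if "l \<ge> max 1 l0" and k: "k \<in> comparable_times M A \<delta>" for l k
      proof -
        have l: "l \<ge> 1" "l \<ge> l0" using that by auto
        have kl: "\<delta> \<le> prob (A l) * real (k l)" "prob (A l) * real (k l) \<le> inverse \<delta>"
          using k l by (auto simp: comparable_times_def)
        then obtain n where n: "k l = Suc n" using \<delta> by (cases "k l") auto
        show ?thesis using l0[OF l(2), of n] kl unfolding n hit[OF l(1)] by blast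
      qed
      then show "\<exists>l0. \<forall>l\<ge>l0. \<forall>k\<in>comparable_times M A \<delta>.
          \<bar>prob {x \<in> space M. hitting_time T (A l) x = enat (k l)} /
          (\<theta> * exp (- \<theta> * prob (A l) * real (k l)) * prob (A l)) - 1\<bar> < \<epsilon>"
        by blast
    qed
  next
    assume ?U
    show ?W
      unfolding W
    proof (intro allI impI)
      fix t :: real assume "t \<ge> 0"
      show "(\<lambda>l. q l (nat \<lfloor>t / prob (A l)\<rfloor>)) \<longlonglongrightarrow> exp (- \<theta> * t)"
      proof (rule cdf_limit_from_local_limit)
        fix l :: nat and n assume l: "l \<ge> 1"
        show "q l 0 = 1" by (simp add: q_def prob_space)
        show "0 \<le> q l n - q l (Suc n)" using decseqD[OF dec[OF l], of n "Suc n"] by simp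
        show "q l n - q l (Suc n) \<le> prob (A l)"
          unfolding q_def by (rule prob_survival_set_diff_le[OF A[OF l]])
      next
        fix \<delta> \<epsilon> :: real assume \<delta>: "0 < \<delta>" "\<delta> \<le> 1 / 2" and "\<epsilon> > 0"
        then have "\<delta> \<in> {0<..1}" by simp
        with \<open>?U\<close> \<open>\<epsilon> > 0\<close> obtain l0 where l0: "\<And>l k. l \<ge> l0 \<Longrightarrow> k \<in> comparable_times M A \<delta> \<Longrightarrow>
            \<bar>prob {x \<in> space M. hitting_time T (A l) x = enat (k l)} /
            (\<theta> * exp (- \<theta> * prob (A l) * real (k l)) * prob (A l)) - 1\<bar> < \<epsilon>"
          unfolding uniform_asymp_equiv_def by meson
        show "\<forall>\<^sub>F l in sequentially.
          \<forall>n. \<delta> \<le> prob (A l) * real (Suc n) \<and> prob (A l) * real (Suc n) \<le> inverse \<delta> \<longrightarrow>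
          \<bar>(q l n - q l (Suc n)) / (\<theta> * exp (- \<theta> * prob (A l) * real (Suc n)) * prob (A l)) - 1\<bar> < \<epsilon>"
        proof (intro eventually_sequentiallyI[of "max 1 l0"] allI impI, elim conjE)
          fix l n assume "max 1 l0 \<le> l"
            and n: "\<delta> \<le> prob (A l) * real (Suc n)" "prob (A l) * real (Suc n) \<le> inverse \<delta>"
          then have l: "l \<ge> 1" "l \<ge> l0" by auto
          \<comment> \<open>The single time \<open>Suc n\<close> is embedded in a full comparable
            sequence, to which the uniform hypothesis applies.\<close>
          from comparable_times_extend[where A = A, OF pos \<delta> n]
          obtain \<kappa> where \<kappa>: "\<kappa> \<in> comparable_times M A \<delta>" "\<kappa> l = Suc n" by blast
          show "\<bar>(q l n - q l (Suc n)) / (\<theta> * exp (- \<theta> * prob (A l) * real (Suc n)) * prob (A l)) - 1\<bar> < \<epsilon>"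
            using l0[OF l(2) \<kappa>(1)] unfolding \<kappa>(2) hit[OF l(1)] .
        qed
      qed (use \<open>\<theta> > 0\<close> \<open>t \<ge> 0\<close> pos lim0 in auto)
    qed
  qed
qed

text \<open>The linear lower bound on survival passes to the limit as
  \<open>1 - t \<le> exp (- \<theta> * t)\<close>. Both sides equal \<open>1\<close> at
  \<open>t = 0\<close>, so a rate above \<open>1\<close> would make the right side fall faster
  there.\<close>

lemma exponential_limit_rate_le_1:
  assumes A: "\<And>l. l \<ge> 1 \<Longrightarrow> A l \<in> sets M" and pos: "\<And>l. l \<ge> 1 \<Longrightarrow> prob (A l) > 0"
    and W: "weak_conv (\<lambda>l. normalized_hitting_cdf M T (A l))
      (\<lambda>t. if t < 0 then 0 else 1 - exp (- \<theta> * t))"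
  shows "\<theta> \<le> 1"
proof (rule ccontr)
  assume "\<not> \<theta> \<le> 1"
  have "1 - t \<le> exp (- \<theta> * t)" if "t \<ge> 0" for t
  proof (rule tendsto_lowerbound)
    show "(\<lambda>l. prob (survival_set M T (A l) (nat \<lfloor>t / prob (A l)\<rfloor>))) \<longlonglongrightarrow> exp (- \<theta> * t)"
      using weak_conv_exponential_iff[where A = A and \<theta> = \<theta>, OF A pos] W that by blast
    show "\<forall>\<^sub>F l in sequentially. 1 - t \<le> prob (survival_set M T (A l) (nat \<lfloor>t / prob (A l)\<rfloor>))"
    proof (rule eventually_sequentiallyI[of 1])
      fix l :: nat assume l: "1 \<le> l"
      have "prob (A l) * real (nat \<lfloor>t / prob (A l)\<rfloor>) \<le> t"
        using that pos[OF l] floor_divide_lower[of "prob (A l)" t] by (simp add: mult.commute)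
      then show "1 - t \<le> prob (survival_set M T (A l) (nat \<lfloor>t / prob (A l)\<rfloor>))"
        using prob_survival_set_ge[OF A[OF l], of "nat \<lfloor>t / prob (A l)\<rfloor>"] by linarith
    qed
  qed simp
  \<comment> \<open>This \<open>t\<close> gives \<open>\<theta> * t = (\<theta> - 1) / 2\<close>,
    half of the gap \<open>\<theta> - 1\<close>, so that \<open>(1 - t) * (1 + \<theta> * t)\<close>
    still exceeds \<open>1\<close>.\<close>
  moreover have "exp (- \<theta> * t) < 1 - t" if "t = (\<theta> - 1) / (2 * \<theta>)" for t
  proof -
    have t: "0 < t" "\<theta> * t = (\<theta> - 1) / 2"
      unfolding that using \<open>\<not> \<theta> \<le> 1\<close> by auto
    have "t < 1" unfolding that using \<open>\<not> \<theta> \<le> 1\<close> by (simp add: divide_less_eq)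
    have "1 < (1 - t) * (1 + \<theta> * t)"
    proof -
      have "(1 - t) * (1 + \<theta> * t) - 1 = t * (\<theta> - 1 - \<theta> * t)" by (simp add: algebra_simps)
      also have "\<dots> > 0" using t \<open>\<not> \<theta> \<le> 1\<close> by (intro mult_pos_pos) auto
      finally show ?thesis by simp
    qed
    also have "\<dots> \<le> (1 - t) * exp (\<theta> * t)"
      using exp_ge_add_one_self[of "\<theta> * t"] \<open>t < 1\<close> by (intro mult_left_mono) auto
    finally show ?thesis by (simp add: exp_minus field_simps)
  qed
  moreover have "(\<theta> - 1) / (2 * \<theta>) \<ge> 0" using \<open>\<not> \<theta> \<le> 1\<close> by simp
  ultimately show False by (meson not_le)
qed

end

theorem theorem1p1:
  fixes M :: "'a measure" and T :: "'a \<Rightarrow> 'a" and A :: "nat \<Rightarrow> 'a set" and \<theta> :: real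
  assumes "ergodic_mpt M T"
    and "\<And>l. l \<ge> 1 \<Longrightarrow> A l \<in> sets M"
    and "\<And>l. l \<ge> 1 \<Longrightarrow> measure M (A l) > 0"
    and "(\<lambda>l. measure M (A l)) \<longlonglongrightarrow> 0"
    and "\<theta> > 0"
  shows
    "(weak_conv (\<lambda>l. normalized_hitting_cdf M T (A l))
        (\<lambda>t. if t < 0 then 0 else 1 - exp (- \<theta> * t))
      \<longleftrightarrow>
      (\<forall>\<delta>\<in>{0<..1}. uniform_asymp_equiv (comparable_times M A \<delta>)
        (\<lambda>k l. measure M {x \<in> space M. hitting_time T (A l) x = enat (k l)})
        (\<lambda>k l. \<theta> * exp (- \<theta> * measure M (A l) * real (k l)) * measure M (A l))))
     \<and>
     (weak_conv (\<lambda>l. normalized_hitting_cdf M T (A l))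
        (\<lambda>t. if t < 0 then 0 else 1 - exp (- \<theta> * t))
      \<longrightarrow> \<theta> \<in> {0<..1})
     \<and>
     (weak_conv (\<lambda>l. normalized_hitting_cdf M T (A l))
        (\<lambda>t. if t < 0 then 0 else 1 - exp (- t))
      \<longleftrightarrow>
      (\<forall>\<delta>\<in>{0<..1}. uniform_asymp_equiv (comparable_times M A \<delta>)
        (\<lambda>k l. measure M {x \<in> space M. hitting_time T (A l) x = enat (k l)})
        (\<lambda>k l. exp (- measure M (A l) * real (k l)) * measure M (A l))))"
proof -
  interpret ergodic_mpt M T by fact
  note A = assms(2) and pos = assms(3)
  show ?thesis
    using hitting_time_local_limit_iff[where A = A and \<theta> = \<theta>, OF A pos assms(4,5)]
      hitting_time_local_limit_iff[where A = A and \<theta> = 1, OF A pos assms(4)]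
      exponential_limit_rate_le_1[where A = A and \<theta> = \<theta>, OF A pos] assms(5)
    by (simp cong: if_cong)
qed

end
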